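(* Let $f\in\dot H^{-2}(\Omega)$ be time-independent, let $u_0,\tilde u_0\in L^2(\Omega)$, and let $u,\tilde u$ be the solutions of problem (P) with source $f$ and initial data $u_0,\tilde u_0$ respectively. Let $0<T<\tilde T$. Then there is a constant $c>0$ independent of $T,\tilde T,u_0,\tilde u_0$ such that $$\|u_0-\tilde u_0\|_{L^2(\Omega)}\le c\,(1+c\tilde T^\alpha)\Big(\|A(u(T)-\tilde u(\tilde T))\|_{L^2(\Omega)}+c\,|T-\tilde T|\,T^{-1-\alpha}\|u_0-A^{-1}f\|_{L^2(\Omega)}\Big).$$
   Context: Let $\Omega\subset\mathbb{R}^d$ ($d=1,2,3$) be an open bounded smooth domain, $\alpha\in(0,1)$, and $q\in L^\infty(\Omega)$, $q\ge 0$, a fixed known potential. Let $A=-\Delta+q$ with zero Dirichlet boundary condition on $L^2(\Omega)$, with eigenvalues $0<\lambda_1\le\lambda_2\le\dots\to\infty$ and $L^2$-orthonormal eigenfunctions $\{\varphi_n\}$. For $s\ge0$, $\dot H^s(\Omega)=\{v\in L^2(\Omega):\sum_n\lambda_n^s(v,\varphi_n)^2<\infty\}$, and $\dot H^{-s}(\Omega)$ is its dual. $E_{\alpha,\beta}(z)=\sum_{k\ge0}z^k/\Gamma(k\alpha+\beta)$. Define $F(t)v=\sum_n E_{\alpha,1}(-\lambda_nt^\alpha)(v,\varphi_n)\varphi_n$. Problem (P) is $\partial_t^\alpha u-\Delta u+qu=f$ in $\Omega\times(0,\infty)$, $u=0$ on $\partial\Omega$, $u(0)=u_0$, with the Caputo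 derivative $\partial_t^\alpha u(t)=\frac1{\Gamma(1-\alpha)}\int_0^t(t-s)^{-\alpha}u'(s)\,ds$; for time-independent $f$ its solution is $u(t)=F(t)u_0+A^{-1}(I-F(t))f$. *)

theory Defs
  imports "HOL-Analysis.Analysis"
begin

text \<open>Spectral setting. The Hilbert space L2(Omega) is an abstract real Hilbert space 'a,
  phi n are the L2-orthonormal eigenfunctions of A = -Laplace + q (Dirichlet), lambda n the
  eigenvalues. Everything in the paper is defined through these eigen-expansions.\<close>

definition dirichlet_spectrum :: "(nat \<Rightarrow> real) \<Rightarrow> (nat \<Rightarrow> 'a::{real_inner,complete_space}) \<Rightarrow> bool" where
  "dirichlet_spectrum lam phi \<longleftrightarrow>
     (\<forall>n. 0 < lam n) \<and> mono lam \<and> filterlim lam at_top sequentially \<and>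
     (\<forall>m n. inner (phi m) (phi n) = (if m = n then 1 else 0)) \<and>
     (\<forall>v. (\<lambda>n. inner v (phi n) *\<^sub>R phi n) sums v)"

definition mittag_leffler :: "real \<Rightarrow> real \<Rightarrow> real \<Rightarrow> real" where
  "mittag_leffler a b z = (\<Sum>k. z ^ k / Gamma (real k * a + b))"

text \<open>Membership of a distribution f in dot-H^s, f represented by its coefficients
  fc n = <f, phi n> (duality pairing).\<close>
definition in_Hdot :: "(nat \<Rightarrow> real) \<Rightarrow> real \<Rightarrow> (nat \<Rightarrow> real) \<Rightarrow> bool" where
  "in_Hdot lam s fc \<longleftrightarrow> summable (\<lambda>n. lam n powr s * (fc n)\<^sup>2)"

definition solF :: "real \<Rightarrow> (nat \<Rightarrow> real) \<Rightarrow> (nat \<Rightarrow> 'a::{real_inner,complete_space})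
     \<Rightarrow> real \<Rightarrow> 'a \<Rightarrow> 'a" where
  "solF alpha lam phi t v =
     (\<Sum>n. (mittag_leffler alpha 1 (- lam n * t powr alpha) * inner v (phi n)) *\<^sub>R phi n)"

text \<open>Solution of (P) with time-independent source f (coefficients fc) and initial datum u0:
  u(t) = F(t) u0 + A^{-1}(I - F(t)) f.\<close>
definition solP :: "real \<Rightarrow> (nat \<Rightarrow> real) \<Rightarrow> (nat \<Rightarrow> 'a::{real_inner,complete_space})
     \<Rightarrow> (nat \<Rightarrow> real) \<Rightarrow> 'a \<Rightarrow> real \<Rightarrow> 'a" where
  "solP alpha lam phi fc u0 t =
     solF alpha lam phi t u0 +
     (\<Sum>n. ((1 - mittag_leffler alpha 1 (- lam n * t powr alpha)) * fc n / lam n) *\<^sub>R phi n)"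

definition Ainv :: "(nat \<Rightarrow> real) \<Rightarrow> (nat \<Rightarrow> 'a::{real_inner,complete_space}) \<Rightarrow> (nat \<Rightarrow> real) \<Rightarrow> 'a" where
  "Ainv lam phi fc = (\<Sum>n. (fc n / lam n) *\<^sub>R phi n)"

text \<open>A v lies in L2 iff sum lambda_n^2 (v,phi_n)^2 < infinity; its L2 norm (Parseval).\<close>
definition A_in_L2 :: "(nat \<Rightarrow> real) \<Rightarrow> (nat \<Rightarrow> 'a::real_inner) \<Rightarrow> 'a \<Rightarrow> bool" where
  "A_in_L2 lam phi v \<longleftrightarrow> summable (\<lambda>n. (lam n * inner v (phi n))\<^sup>2)"

definition A_L2norm :: "(nat \<Rightarrow> real) \<Rightarrow> (nat \<Rightarrow> 'a::real_inner) \<Rightarrow> 'a \<Rightarrow> real" where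
  "A_L2norm lam phi v = sqrt (\<Sum>n. (lam n * inner v (phi n))\<^sup>2)"

end

theory Submission
  imports Defs "HOL-Real_Asymp.Real_Asymp"
begin

text \<open>Write \<open>g(t) = E\<^bsub>a,1\<^esub>(-t\<^sup>a)\<close> and \<open>r = -g'\<close>. Termwise use of the Beta integral shows that \<open>r\<close> and \<open>g\<close>
  solve Volterra equations with the fractional kernel \<open>k(t) = t\<^bsup>a-1\<^esup>/\<Gamma>(a)\<close>: \<open>r + k*r = k\<close> and \<open>g + k*g = 1\<close>,
  and that \<open>g = l*r\<close> for the conjugate kernel \<open>l(t) = t\<^bsup>-a\<^esup>/\<Gamma>(1-a)\<close>. Since \<open>k\<close> is log-convex, a solution of
  \<open>z + k*z = F\<close> with \<open>F/k\<close> nondecreasing stays positive. Hence \<open>r > 0\<close>, so \<open>g\<close> decreases, and monotonicity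
  of \<open>l\<close> and \<open>g\<close> in the convolutions bounds \<open>g\<close> below and above by multiples of \<open>1/(1+t\<^sup>a)\<close>. Applying
  positivity to \<open>M g - t r\<close> gives \<open>t r \<le> M g\<close>, thus \<open>r \<le> C t\<^bsup>-1-a\<^esup>\<close>.
  With \<open>w = u\<^sub>0 - A\<^sup>-\<^sup>1f\<close> the \<open>n\<close>-th coefficient of \<open>u(T) - u'(T')\<close> is \<open>g\<^sub>n(T) w\<^sub>n - g\<^sub>n(T') w'\<^sub>n\<close>; dividing by
  \<open>g\<^sub>n(T')\<close> and using the lower bound at \<open>T'\<close> and the Lipschitz bound on \<open>[T, T']\<close> gives the estimate
  coefficientwise.\<close>

section \<open>Riemann-Liouville kernels, resolvents and their convolutions\<close>

text \<open>Convolution with this kernel is the fractional integral of order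
  \<open>b\<close>.\<close>

definition frac_kernel :: "real \<Rightarrow> real \<Rightarrow> real" where
  "frac_kernel b t = t powr (b - 1) / Gamma b"

text \<open>The index \<open>b = \<alpha>\<close> gives the resolvent \<open>r\<close> of the kernel
  of order \<open>\<alpha>\<close>, and \<open>b = 1\<close> gives \<open>g\<close>.\<close>

definition frac_resolvent :: "real \<Rightarrow> real \<Rightarrow> real \<Rightarrow> real" where
  "frac_resolvent \<alpha> b t = t powr (b - 1) * mittag_leffler \<alpha> b (- (t powr \<alpha>))"

text \<open>Encoded through \<open>has_bochner_integral\<close>, so that integrability across the
  endpoint singularities comes together with the value.\<close>

definition has_convolution :: "(real \<Rightarrow> real) \<Rightarrow> (real \<Rightarrow> real) \<Rightarrow> real \<Rightarrow> real \<Rightarrow> bool" where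
  "has_convolution f g t I \<longleftrightarrow>
     has_bochner_integral lborel (\<lambda>s. indicator {0<..<t} s * (f (t - s) * g s)) I"

lemma frac_kernel_pos: "0 < b \<Longrightarrow> 0 < t \<Longrightarrow> 0 < frac_kernel b t"
  by (simp add: frac_kernel_def)

text \<open>Semigroup law of fractional integration: the substitution \<open>s = t x\<close> turns
  the convolution into the Beta integral over the unit interval.\<close>

lemma frac_kernel_convolution:
  assumes "0 < a" "0 < b" "0 < t"
  shows "has_convolution (frac_kernel a) (frac_kernel b) t (frac_kernel (a + b) t)"
proof -
  let ?h = "\<lambda>x::real. indicator {0..1} x * (x powr (b - 1) * (1 - x) powr (a - 1))"
  have int: "set_integrable lborel {0..1} (\<lambda>x::real. x powr (b - 1) * (1 - x) powr (a - 1))"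
    using assms by (intro integrable_Beta) auto
  have "(LBINT x:{0..1}. x powr (b - 1) * (1 - x) powr (a - 1)) = Beta b a"
    using set_borel_integral_eq_integral(2)[OF int] has_integral_Beta_real[of b a] assms
    by (simp add: integral_unique)
  then have "has_bochner_integral lborel ?h (Beta b a)"
    using int by (simp add: has_bochner_integral_iff set_integrable_def set_lebesgue_integral_def)
  then have "has_bochner_integral lborel (\<lambda>s. ?h (0 + inverse t * s)) (Beta b a /\<^sub>R \<bar>inverse t\<bar>)"
    using assms by (subst (asm) lborel_has_bochner_integral_real_affine_iff[where c="inverse t" and t=0]) auto
  then have "has_bochner_integral lborel (\<lambda>s. (t powr (a + b - 2) / (Gamma a * Gamma b)) * ?h (0 + inverse t * s))
     ((t powr (a + b - 2) / (Gamma a * Gamma b)) * (Beta b a /\<^sub>R \<bar>inverse t\<bar>))"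
    by (rule has_bochner_integral_mult_right)
  moreover have "(t powr (a + b - 2) / (Gamma a * Gamma b)) * (Beta b a /\<^sub>R \<bar>inverse t\<bar>) = frac_kernel (a + b) t"
  proof -
    have "Gamma a \<noteq> 0" "Gamma b \<noteq> 0" using assms by (auto simp: Gamma_eq_zero_iff dest!: nonpos_Ints_nonpos)
    moreover have "t powr (a + b - 2) * t = t powr (a + b - 1)"
      using powr_add[of t "a + b - 2" 1] assms by simp
    ultimately show ?thesis
      using assms by (simp add: Beta_def frac_kernel_def field_simps)
  qed
  moreover have "(t powr (a + b - 2) / (Gamma a * Gamma b)) * ?h (0 + inverse t * s)
      = indicator {0<..<t} s * (frac_kernel a (t - s) * frac_kernel b s)" for s
  proof (cases "0 < s \<and> s < t")
    case True
    have "1 - s / t = (t - s) / t" using assms by (simp add: field_simps)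
    moreover have "t powr (a + b - 2) = t powr (a - 1) * t powr (b - 1)"
      by (simp flip: powr_add add: algebra_simps)
    moreover have "t powr (a - 1) \<noteq> 0" "t powr (b - 1) \<noteq> 0"
      using assms by auto
    ultimately show ?thesis using True assms
      by (simp add: frac_kernel_def powr_divide field_simps)
  next
    case False
    \<comment> \<open>At \<open>s = 0\<close> and \<open>s = t\<close> only the closed indicator is
      1, but there \<open>0 powr x = 0\<close> makes the left side vanish as well.\<close>
    then consider "s = 0" | "s = t" | "s < 0" | "t < s" by linarith
    then show ?thesis using assms by cases (auto simp: indicator_def field_simps)
  qed
  ultimately show ?thesis
    by (simp add: has_convolution_def)
qed

section \<open>Convergence of the Mittag-Leffler series\<close>

text \<open>Log-convexity of Gamma, applied to \<open>x + 1\<close> as the convex combination of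
  \<open>x + a\<close> and \<open>x + a + 1\<close> with weights \<open>a\<close> and
  \<open>1 - a\<close>.\<close>

lemma Gamma_shift_lower_bound:
  fixes x a :: real
  assumes "0 < x" "0 < a" "a < 1"
  shows "x * Gamma x \<le> Gamma (x + a) * (x + a) powr (1 - a)"
proof -
  have "ln (Gamma ((1 - (1 - a)) * (x + a) + (1 - a) * (x + a + 1))) \<le>
      (1 - (1 - a)) * ln (Gamma (x + a)) + (1 - a) * ln (Gamma (x + a + 1))"
    using convex_onD[OF log_convex_Gamma_real, of "1 - a" "x + a" "x + a + 1"] assms by simp
  moreover have "(1 - (1 - a)) * (x + a) + (1 - a) * (x + a + 1) = x + 1"
    by (simp add: algebra_simps)
  moreover have "Gamma (x + 1) = x * Gamma x"
    using assms by (intro Gamma_plus1) (auto dest!: nonpos_Ints_nonpos)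
  moreover have "Gamma (x + a + 1) = (x + a) * Gamma (x + a)"
    using assms by (intro Gamma_plus1) (auto dest!: nonpos_Ints_nonpos)
  ultimately have "ln (x * Gamma x) \<le> a * ln (Gamma (x + a)) + (1 - a) * ln ((x + a) * Gamma (x + a))"
    by simp
  also have "\<dots> = ln (Gamma (x + a)) + (1 - a) * ln (x + a)"
    using assms by (subst ln_mult_pos) (auto simp: algebra_simps)
  also have "\<dots> = ln (Gamma (x + a) * (x + a) powr (1 - a))"
    using assms by (subst ln_mult_pos) (auto simp: ln_powr)
  finally show ?thesis
    using assms by (simp add: Gamma_real_pos)
qed

text \<open>Ratio test: by \<open>Gamma_shift_lower_bound\<close> the quotient of consecutive Gamma
  values decays like \<open>x powr (-a)\<close>.\<close>

lemma mittag_leffler_summable: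
  fixes a b z :: real
  assumes "0 < a" "a < 1" "0 < b"
  shows "summable (\<lambda>k. z ^ k / Gamma (real k * a + b))"
proof -
  have pos: "0 < real k * a + b" for k using assms by (simp add: add_nonneg_pos)
  have "((\<lambda>x::real. (x + a) powr (1 - a) / x) \<longlongrightarrow> 0) at_top"
    using assms by real_asymp
  moreover have "filterlim (\<lambda>k. real k * a + b) at_top sequentially"
    using assms by real_asymp
  ultimately have "((\<lambda>k. (real k * a + b + a) powr (1 - a) / (real k * a + b)) \<longlongrightarrow> 0) sequentially"
    by (rule filterlim_compose)
  \<comment> \<open>This threshold brings the ratio of consecutive terms below 1/2; the added 1
    covers \<open>z = 0\<close>.\<close>
  then have "\<forall>\<^sub>F k in sequentially. (real k * a + b + a) powr (1 - a) / (real k * a + b) < 1 / (2 * (\<bar>z\<bar> + 1))"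
    by (rule order_tendstoD) auto
  then obtain N where N: "\<And>k. k \<ge> N \<Longrightarrow>
      (real k * a + b + a) powr (1 - a) / (real k * a + b) < 1 / (2 * (\<bar>z\<bar> + 1))"
    by (auto simp: eventually_sequentially)
  show ?thesis
  proof (rule summable_ratio_test[of "1/2" N])
    fix k assume "k \<ge> N"
    define x where "x = real k * a + b"
    have x: "0 < x" using pos by (simp add: x_def)
    have G: "0 < Gamma x" "0 < Gamma (x + a)" using x assms by auto
    have "Gamma x / Gamma (x + a) \<le> (x + a) powr (1 - a) / x"
      using Gamma_shift_lower_bound[OF x assms(1,2)] x G by (simp add: field_simps)
    also have "\<dots> \<le> 1 / (2 * (\<bar>z\<bar> + 1))" using N[OF \<open>k \<ge> N\<close>] by (simp add: x_def)
    finally have "\<bar>z\<bar> * (Gamma x / Gamma (x + a)) \<le> \<bar>z\<bar> * (1 / (2 * (\<bar>z\<bar> + 1)))"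
      by (intro mult_left_mono) auto
    also have "\<dots> \<le> 1 / 2" by (simp add: field_simps)
    finally have le: "\<bar>z\<bar> * (Gamma x / Gamma (x + a)) \<le> 1 / 2" .
    have "norm (z ^ Suc k / Gamma (real (Suc k) * a + b)) = \<bar>z\<bar> ^ Suc k / Gamma (x + a)"
      using G by (simp add: x_def power_abs abs_mult algebra_simps)
    also have "\<dots> = (\<bar>z\<bar> * (Gamma x / Gamma (x + a))) * (\<bar>z\<bar> ^ k / Gamma x)"
      using G by (simp add: field_simps)
    also have "\<dots> \<le> 1 / 2 * (\<bar>z\<bar> ^ k / Gamma x)"
      using G by (intro mult_right_mono le) auto
    finally show "norm (z ^ Suc k / Gamma (real (Suc k) * a + b)) \<le> 1 / 2 * norm (z ^ k / Gamma (real k * a + b))"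
      using G by (simp add: x_def power_abs)
  qed simp
qed

section \<open>Resolvent series and their convolution identities\<close>

text \<open>The factor \<open>c\<close> is left free because -1 yields the resolvent and 1 yields
  the series of absolute values.\<close>

lemma frac_kernel_series:
  assumes "0 < t"
  shows "t powr (b - 1) * ((c * (t powr a)) ^ k / Gamma (real k * a + b)) = c ^ k * frac_kernel (real k * a + b) t"
proof -
  have "(t powr a) ^ k = t powr (real k * a)"
    using assms by (simp flip: powr_realpow add: powr_powr mult.commute)
  then show ?thesis
    by (simp add: frac_kernel_def power_mult_distrib algebra_simps flip: powr_add)
qed

lemma frac_resolvent_sums:
  assumes "0 < a" "a < 1" "0 < b" "0 < t"
  shows "(\<lambda>k. (-1) ^ k * frac_kernel (real k * a + b) t) sums frac_resolvent a b t"
    and "summable (\<lambda>k. frac_kernel (real k * a + b) t)"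
proof -
  have "(\<lambda>k. ((-1) * (t powr a)) ^ k / Gamma (real k * a + b)) sums mittag_leffler a b (- (t powr a))"
    using summable_sums[OF mittag_leffler_summable[OF assms(1-3), of "- (t powr a)"]]
    by (simp add: mittag_leffler_def)
  from sums_mult[OF this, of "t powr (b - 1)"]
  show "(\<lambda>k. (-1) ^ k * frac_kernel (real k * a + b) t) sums frac_resolvent a b t"
    by (simp only: frac_kernel_series[OF assms(4)] frac_resolvent_def)
  have "summable (\<lambda>k. t powr (b - 1) * ((1 * (t powr a)) ^ k / Gamma (real k * a + b)))"
    using mittag_leffler_summable[OF assms(1-3), of "t powr a"] by (intro summable_mult) simp
  then show "summable (\<lambda>k. frac_kernel (real k * a + b) t)"
    by (simp only: frac_kernel_series[OF assms(4)]) simp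
qed

text \<open>Dropping the first term of the alternating series raises \<open>b\<close> by
  \<open>a\<close> and flips the sign. Combined with the convolution identity below, this produces
  the Volterra equations.\<close>

lemma frac_resolvent_shift:
  assumes "0 < a" "a < 1" "0 < b" "0 < t"
  shows "frac_resolvent a (b + a) t = frac_kernel b t - frac_resolvent a b t"
proof -
  have "(\<lambda>k. (-1) ^ Suc k * frac_kernel (real (Suc k) * a + b) t) sums
      (frac_resolvent a b t - (-1) ^ 0 * frac_kernel (real 0 * a + b) t)"
    using frac_resolvent_sums(1)[OF assms] by (subst sums_Suc_iff) simp
  from sums_minus[OF this]
  have "(\<lambda>k. (-1) ^ k * frac_kernel (real k * a + (b + a)) t) sums (frac_kernel b t - frac_resolvent a b t)"
    by (simp add: algebra_simps)
  then show ?thesis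
    using frac_resolvent_sums(1)[of a "b + a" t] assms sums_unique2 by auto
qed

text \<open>The semigroup law is applied to each term of the series. Sum and integral may be
  exchanged because the kernels are positive: the integrals of the absolute values are again kernels
  at \<open>t\<close>, and these are summable.\<close>

lemma frac_kernel_resolvent_convolution:
  assumes "0 < a" "a < 1" "0 < b" "0 < c" "0 < t"
  shows "has_convolution (frac_kernel c) (frac_resolvent a b) t (frac_resolvent a (c + b) t)"
proof -
  let ?f = "\<lambda>k s. indicator {0<..<t} s * (frac_kernel c (t - s) * ((-1) ^ k * frac_kernel (real k * a + b) s))"
  have pos: "0 < real k * a + b" for k using assms by (simp add: add_nonneg_pos)
  have K: "has_bochner_integral lborel
      (\<lambda>s. indicator {0<..<t} s * (frac_kernel c (t - s) * frac_kernel (real k * a + b) s))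
      (frac_kernel (real k * a + (c + b)) t)" for k
    using frac_kernel_convolution[OF assms(4) pos assms(5), of k]
    by (simp add: has_convolution_def algebra_simps)
  have f: "has_bochner_integral lborel (?f k) ((-1) ^ k * frac_kernel (real k * a + (c + b)) t)" for k
    using has_bochner_integral_mult_right[OF K[of k], of "(-1) ^ k"] by (simp add: algebra_simps)
  have nf: "norm (?f k s) = indicator {0<..<t} s * (frac_kernel c (t - s) * frac_kernel (real k * a + b) s)" for k s
    using frac_kernel_pos[OF pos, of s k] frac_kernel_pos[OF assms(4), of "t - s"]
    by (auto simp: indicator_def abs_mult power_abs)
  have sum: "(\<lambda>k. ?f k s) sums (indicator {0<..<t} s * (frac_kernel c (t - s) * frac_resolvent a b s))" for s
    using frac_resolvent_sums(1)[OF assms(1-3), of s]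
    by (cases "s \<in> {0<..<t}") (auto intro!: sums_mult)
  have int: "\<And>k. integrable lborel (?f k)"
    using f by (auto simp: has_bochner_integral_iff)
  have AE: "AE s in lborel. summable (\<lambda>k. norm (?f k s))"
  proof (intro AE_I2)
    fix s :: real
    show "summable (\<lambda>k. norm (?f k s))"
      using frac_resolvent_sums(2)[OF assms(1-3), of s]
      unfolding nf by (cases "s \<in> {0<..<t}") (auto intro!: summable_mult)
  qed
  have "summable (\<lambda>k. frac_kernel (real k * a + (c + b)) t)"
    using frac_resolvent_sums(2)[of a "c + b" t] assms by simp
  then have S: "summable (\<lambda>k. \<integral>s. norm (?f k s) \<partial>lborel)"
    unfolding nf has_bochner_integral_integral_eq[OF K] .
  have "(\<lambda>k. integral\<^sup>L lborel (?f k)) sums frac_resolvent a (c + b) t"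
    unfolding has_bochner_integral_integral_eq[OF f]
    using frac_resolvent_sums(1)[of a "c + b" t] assms by simp
  with sums_integral[OF int AE S] have "(\<integral>s. (\<Sum>k. ?f k s) \<partial>lborel) = frac_resolvent a (c + b) t"
    by (rule sums_unique2)
  with integrable_suminf[OF int AE S] sum show ?thesis
    by (simp add: has_convolution_def has_bochner_integral_iff sums_unique[OF sum, symmetric])
qed

section \<open>Differentiability and continuity\<close>

text \<open>In the differentiated series the factor \<open>k + 1\<close> cancels against the
  functional equation of Gamma, leaving \<open>1 / a\<close>.\<close>

lemma mittag_leffler_has_derivative:
  assumes "0 < a" "a < 1"
  shows "(mittag_leffler a 1 has_field_derivative mittag_leffler a a z / a) (at z)"
proof -
  let ?c = "\<lambda>k. 1 / Gamma (real k * a + 1)"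
  have "((\<lambda>z. \<Sum>k. ?c k * z ^ k) has_field_derivative (\<Sum>k. diffs ?c k * z ^ k)) (at z)"
    using mittag_leffler_summable[OF assms, of 1] by (intro termdiffs_strong_converges_everywhere) simp
  moreover have "diffs ?c k * z ^ k = (z ^ k / Gamma (real k * a + a)) / a" for k
  proof -
    have "0 < real k * a + a" using assms by (simp add: add_nonneg_pos)
    then have "Gamma (real k * a + a + 1) = (real k * a + a) * Gamma (real k * a + a)"
      by (intro Gamma_plus1) (auto dest!: nonpos_Ints_nonpos)
    moreover have "real (Suc k) * a + 1 = real k * a + a + 1" by (simp add: algebra_simps)
    ultimately have "Gamma (real (Suc k) * a + 1) = (real k * a + a) * Gamma (real k * a + a)"
      by simp
    then have "diffs ?c k = real (Suc k) / ((real (Suc k) * a) * Gamma (real k * a + a))"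
      by (simp add: diffs_def algebra_simps)
    then show ?thesis by simp
  qed
  moreover have "(\<Sum>k. (z ^ k / Gamma (real k * a + a)) / a) = mittag_leffler a a z / a"
    unfolding mittag_leffler_def
    by (rule suminf_divide[OF mittag_leffler_summable]) (use assms in auto)
  moreover have "(\<lambda>z. \<Sum>k. ?c k * z ^ k) = mittag_leffler a 1"
    by (simp add: mittag_leffler_def fun_eq_iff)
  ultimately show ?thesis by simp
qed

lemma continuous_mittag_leffler:
  assumes "0 < a" "a < 1" "0 < b"
  shows "continuous_on UNIV (mittag_leffler a b)"
proof -
  let ?c = "\<lambda>k. 1 / Gamma (real k * a + b)"
  have "((\<lambda>z. \<Sum>k. ?c k * z ^ k) has_field_derivative (\<Sum>k. diffs ?c k * z ^ k)) (at z)" for z :: real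
    using mittag_leffler_summable[OF assms] by (intro termdiffs_strong_converges_everywhere) simp
  then have "isCont (\<lambda>z. \<Sum>k. ?c k * z ^ k) z" for z :: real
    by (rule DERIV_isCont)
  then show ?thesis
    by (simp add: mittag_leffler_def[abs_def] continuous_at_imp_continuous_on)
qed

lemma frac_resolvent_1_has_derivative:
  assumes "0 < a" "a < 1" "0 < t"
  shows "(frac_resolvent a 1 has_field_derivative - frac_resolvent a a t) (at t)"
proof -
  have "((\<lambda>t. mittag_leffler a 1 (- (t powr a))) has_field_derivative
      mittag_leffler a a (- (t powr a)) / a * (- (a * t powr (a - 1)))) (at t)"
    using assms by (intro DERIV_chain2[OF mittag_leffler_has_derivative] has_real_derivative_powr DERIV_minus) auto
  moreover have "mittag_leffler a a (- (t powr a)) / a * (- (a * t powr (a - 1))) = - frac_resolvent a a t"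
    using assms by (simp add: frac_resolvent_def)
  ultimately have "((\<lambda>t. mittag_leffler a 1 (- (t powr a))) has_field_derivative - frac_resolvent a a t) (at t)"
    by simp
  \<comment> \<open>The prefactor \<open>t powr 0\<close> equals 1 only away from 0, so the two
    functions are identified on the open half-line.\<close>
  then show ?thesis
    by (rule has_field_derivative_transform_within_open[of _ _ _ "{0<..}"])
       (use assms in \<open>auto simp: frac_resolvent_def\<close>)
qed

lemma continuous_frac_resolvent:
  assumes "0 < a" "a < 1" "0 < b"
  shows "continuous_on {0<..} (frac_resolvent a b)"
  unfolding frac_resolvent_def[abs_def]
  by (intro continuous_intros continuous_on_compose2[OF continuous_mittag_leffler[OF assms]]) auto

section \<open>Comparison of convolutions and positivity for Volterra equations\<close>

lemma has_convolution_mono: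
  assumes "has_convolution f g t I" "has_convolution f' g' t J"
    and "\<And>s. 0 < s \<Longrightarrow> s < t \<Longrightarrow> f (t - s) * g s \<le> f' (t - s) * g' s"
  shows "I \<le> J"
proof -
  have "(\<integral>s. indicator {0<..<t} s * (f (t - s) * g s) \<partial>lborel) \<le>
      (\<integral>s. indicator {0<..<t} s * (f' (t - s) * g' s) \<partial>lborel)"
    using assms unfolding has_convolution_def has_bochner_integral_iff
    by (intro integral_mono) (auto simp: indicator_def)
  then show ?thesis
    using assms(1,2) by (simp add: has_convolution_def has_bochner_integral_iff)
qed

lemma has_convolution_nonneg:
  assumes "has_convolution f g t I" "\<And>s. 0 < s \<Longrightarrow> s < t \<Longrightarrow> 0 \<le> f (t - s) * g s"
  shows "0 \<le> I"
  using has_convolution_mono[of "\<lambda>_. 0" "\<lambda>_. 0" t 0 f g I] assms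
  by (simp add: has_convolution_def has_bochner_integral_zero)

text \<open>The ratio of the two kernel values is \<open>((t - s) / (u - s)) powr (1 - a)\<close>,
  which decreases in \<open>s\<close> and is therefore bounded by its value at
  \<open>s = 0\<close>.\<close>

lemma frac_kernel_ratio_mono:
  assumes "0 < a" "a < 1" "0 < s" "s < t" "t < u"
  shows "frac_kernel a (u - s) \<le> (t / u) powr (1 - a) * frac_kernel a (t - s)"
proof -
  have "(t - s) / (u - s) \<le> t / u"
    using assms by (simp add: field_simps)
  then have "((t - s) / (u - s)) powr (1 - a) \<le> (t / u) powr (1 - a)"
    using assms by (intro powr_mono2) auto
  then have "((t - s) / (u - s)) powr (1 - a) * frac_kernel a (t - s) \<le>
      (t / u) powr (1 - a) * frac_kernel a (t - s)"
    using assms frac_kernel_pos[of a "t - s"] by (intro mult_right_mono) auto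
  moreover have "((t - s) / (u - s)) powr (1 - a) * frac_kernel a (t - s) = frac_kernel a (u - s)"
  proof -
    have "(t - s) powr (1 - a) * (t - s) powr (a - 1) = 1"
      using assms by (simp flip: powr_add)
    moreover have "(u - s) powr (a - 1) = 1 / (u - s) powr (1 - a)"
      using powr_minus_divide[of "u - s" "1 - a"] by simp
    ultimately show ?thesis
      using assms by (simp add: frac_kernel_def powr_divide)
  qed
  ultimately show ?thesis by simp
qed

lemma frac_kernel_tail_integral:
  assumes "0 < a" "t < u"
  shows "has_bochner_integral lborel (\<lambda>s. indicator {t<..<u} s * frac_kernel a (u - s))
    (frac_kernel (a + 1) (u - t))"
proof -
  \<comment> \<open>Since \<open>frac_kernel 1\<close> is 1 on the positive axis, the tail integral
    is a shifted convolution over an interval of length \<open>u - t\<close>.\<close>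
  let ?h = "\<lambda>s. indicator {0<..<u - t} s * (frac_kernel a (u - t - s) * frac_kernel 1 s)"
  have "has_bochner_integral lborel ?h (frac_kernel (a + 1) (u - t))"
    using frac_kernel_convolution[of a 1 "u - t"] assms by (simp add: has_convolution_def)
  then have "has_bochner_integral lborel (\<lambda>s. ?h (- t + 1 * s)) (frac_kernel (a + 1) (u - t) /\<^sub>R \<bar>1\<bar>)"
    by (subst (asm) lborel_has_bochner_integral_real_affine_iff[where c=1 and t="- t"]) auto
  moreover have "(\<lambda>s. ?h (- t + 1 * s)) = (\<lambda>s. indicator {t<..<u} s * frac_kernel a (u - s))"
    by (auto simp: fun_eq_iff indicator_def frac_kernel_def)
  ultimately show ?thesis by (simp only:) simp
qed

text \<open>At a first zero \<open>u\<close> the memory term is compared with the one at an earlier time \<open>t\<close> close to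
  \<open>u\<close> at which \<open>z\<close> is maximal on \<open>[t, u]\<close>: log-convexity of the kernel controls the history
  before \<open>t\<close>, maximality the rest.\<close>

lemma volterra_solution_pos:
  fixes z F :: "real \<Rightarrow> real"
  assumes a: "0 < a" "a < 1"
    and cont: "continuous_on {0<..} z"
    and eq: "\<And>t. 0 < t \<Longrightarrow> has_convolution (frac_kernel a) z t (F t - z t)"
    and mono: "\<And>s t. 0 < s \<Longrightarrow> s \<le> t \<Longrightarrow> s powr (1 - a) * F s \<le> t powr (1 - a) * F t"
    and near: "0 < \<delta>" "\<And>t. 0 < t \<Longrightarrow> t < \<delta> \<Longrightarrow> 0 < z t"
    and "0 < v"
  shows "0 < z v"
proof (rule ccontr)
  assume nz: "\<not> 0 < z v"
  \<comment> \<open>Starting at \<open>\<delta>/2\<close> keeps the set compact and away from 0; no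
    zero is missed, as \<open>z\<close> is positive before \<open>\<delta>\<close>.\<close>
  define S where "S = {s \<in> {\<delta>/2..v}. z s \<le> 0}"
  have "\<delta> \<le> v" using nz near(2)[of v] \<open>0 < v\<close> by force
  have "continuous_on {\<delta>/2..v} z"
    using near(1) by (intro continuous_on_subset[OF cont]) auto
  then have "closed S"
    unfolding S_def by (intro continuous_on_closed_Collect_le continuous_on_const) auto
  moreover have "S \<subseteq> {\<delta>/2..v}" by (auto simp: S_def)
  ultimately have "compact S"
    by (metis compact_Icc compact_Int_closed inf.absorb_iff2)
  moreover have "S \<noteq> {}" using nz \<open>\<delta> \<le> v\<close> near(1) by (auto simp: S_def not_less intro!: exI[of _ v])
  ultimately obtain u where u: "u \<in> S" "\<And>s. s \<in> S \<Longrightarrow> u \<le> s"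
    by (meson compact_attains_inf)
  have u0: "0 < u" "z u \<le> 0" using u(1) near(1) by (auto simp: S_def)
  have before: "0 < z s" if "0 < s" "s < u" for s
  proof (cases "s < \<delta>")
    case False
    then have "s \<notin> S" using u(2)[of s] that by auto
    then show ?thesis using False that u(1) near(1) by (auto simp: S_def)
  qed (use near(2) that in auto)
  \<comment> \<open>The first bound gives \<open>t / u \<ge> 1/2\<close> and hence
    \<open>\<rho> \<ge> 1/2\<close>; the second makes the kernel mass \<open>\<kappa>\<close> on the
    remaining interval at most 1/4.\<close>
  define \<eta> where "\<eta> = min (u / 2) ((Gamma (a + 1) / 4) powr (1 / a))"
  have G: "0 < Gamma (a + 1)" using a by simp
  have \<eta>: "0 < \<eta>" "\<eta> \<le> u / 2" using u0 G by (auto simp: \<eta>_def)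
  have "\<eta> powr a \<le> ((Gamma (a + 1) / 4) powr (1 / a)) powr a"
    using \<eta> a by (intro powr_mono2) (auto simp: \<eta>_def)
  also have "\<dots> = Gamma (a + 1) / 4" using a G by (simp add: powr_powr)
  finally have \<eta>a: "\<eta> powr a \<le> Gamma (a + 1) / 4" .
  have "continuous_on {u - \<eta>..u} z"
    using \<eta> u0 by (intro continuous_on_subset[OF cont]) auto
  then obtain t where t: "u - \<eta> \<le> t" "t \<le> u" "\<And>s. u - \<eta> \<le> s \<Longrightarrow> s \<le> u \<Longrightarrow> z s \<le> z t"
    using continuous_attains_sup[of "{u - \<eta>..u}" z] \<eta> by auto
  have "0 < z (u - \<eta>)" using before[of "u - \<eta>"] \<eta> u0 by auto
  also have "\<dots> \<le> z t" using t(3)[of "u - \<eta>"] \<eta> by auto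
  finally have zt: "0 < z t" .
  have tu: "0 < t" "t < u" using zt u0 t \<eta> by (auto simp: order_le_less)
  define \<rho> where "\<rho> = (t / u) powr (1 - a)"
  define \<kappa> where "\<kappa> = frac_kernel (a + 1) (u - t)"
  have "\<kappa> \<le> 1 / 4"
  proof -
    have "(u - t) powr a \<le> \<eta> powr a" using t tu a by (intro powr_mono2) auto
    with \<eta>a have "(u - t) powr a \<le> Gamma (a + 1) / 4" by linarith
    then show ?thesis using G by (simp add: \<kappa>_def frac_kernel_def field_simps)
  qed
  moreover have "1 / 2 \<le> \<rho>"
  proof -
    have "(1/2::real) powr 1 \<le> (1/2) powr (1 - a)" using a by (intro powr_mono') auto
    also have "\<dots> \<le> \<rho>" unfolding \<rho>_def
      using tu t \<eta> a by (intro powr_mono2) (auto simp: field_simps)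
    finally show ?thesis by simp
  qed
  ultimately have "z t * \<kappa> < z t * \<rho>" using zt by simp
  let ?I = "\<lambda>x s. indicator {0<..<x} s * (frac_kernel a (x - s) * z s)"
  let ?J = "\<lambda>s. indicator {t<..<u} s * frac_kernel a (u - s)"
  have I: "has_bochner_integral lborel (?I x) (F x - z x)" if "0 < x" for x
    using eq[OF that] by (simp add: has_convolution_def)
  have R: "has_bochner_integral lborel (\<lambda>s. \<rho> * ?I t s + z t * ?J s) (\<rho> * (F t - z t) + z t * \<kappa>)"
    unfolding \<kappa>_def using tu a
    by (intro has_bochner_integral_add has_bochner_integral_mult_right I frac_kernel_tail_integral) auto
  \<comment> \<open>The point \<open>s = t\<close> lies in neither open interval on the right; it is
    a null set.\<close>
  have "AE s in lborel. ?I u s \<le> \<rho> * ?I t s + z t * ?J s"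
    using AE_lborel_singleton[of t]
  proof eventually_elim
    case (elim s)
    consider "s \<le> 0 \<or> u \<le> s" | "0 < s" "s < t" | "t < s" "s < u" using elim by linarith
    then show ?case
    proof cases
      case 2
      then have "frac_kernel a (u - s) * z s \<le> \<rho> * frac_kernel a (t - s) * z s"
        unfolding \<rho>_def using frac_kernel_ratio_mono[OF a, of s t u] before[of s] tu
        by (intro mult_right_mono) auto
      then show ?thesis using 2 tu by (simp add: indicator_def mult_ac)
    next
      case 3
      then have "frac_kernel a (u - s) * z s \<le> frac_kernel a (u - s) * z t"
        using frac_kernel_pos[OF a(1), of "u - s"] t by (intro mult_left_mono) auto
      then show ?thesis using 3 tu by (simp add: indicator_def mult_ac)
    qed (use tu in \<open>auto simp: indicator_def\<close>)
  qed
  then have "F u - z u \<le> \<rho> * (F t - z t) + z t * \<kappa>"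
    using integral_mono_AE[of lborel "?I u" "\<lambda>s. \<rho> * ?I t s + z t * ?J s"] I[OF u0(1)] R
    by (simp add: has_bochner_integral_iff)
  \<comment> \<open>The strict inequality comes from \<open>\<kappa> < \<rho>\<close>. With the
    monotonicity hypothesis it gives \<open>F u - z u < F u\<close>, against
    \<open>z u \<le> 0\<close>.\<close>
  also have "\<dots> < \<rho> * F t" using \<open>z t * \<kappa> < z t * \<rho>\<close> by (simp add: algebra_simps)
  also have "\<dots> \<le> F u"
    using mono[of t u] tu by (simp add: \<rho>_def powr_divide field_simps)
  finally show False using u0 by simp
qed

text \<open>Supplies the small-time hypothesis of \<open>volterra_solution_pos\<close>: up to a
  positive factor, the functions concerned are continuous in \<open>t powr a\<close>.\<close>

lemma eventually_pos_powr_at_0: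
  fixes h :: "real \<Rightarrow> real"
  assumes "continuous_on UNIV h" "0 < h 0" "0 < a"
  obtains \<delta> where "0 < \<delta>" "\<And>t. 0 < t \<Longrightarrow> t < \<delta> \<Longrightarrow> 0 < h (t powr a)"
proof -
  have "(h \<longlongrightarrow> h 0) (at 0)"
    using assms(1) by (simp add: continuous_on_eq_continuous_at isCont_def)
  then have "\<forall>\<^sub>F x in at 0. 0 < h x"
    using assms(2) by (rule order_tendstoD)
  then obtain d where d: "0 < d" "\<And>x. x \<noteq> 0 \<Longrightarrow> \<bar>x\<bar> < d \<Longrightarrow> 0 < h x"
    by (auto simp: eventually_at dist_real_def)
  show ?thesis
  proof (rule that[of "d powr (1 / a)"])
    fix t :: real assume t: "0 < t" "t < d powr (1 / a)"
    then have "t powr a < (d powr (1 / a)) powr a" using assms(3) by (intro powr_less_mono2) auto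
    then show "0 < h (t powr a)" using t d assms(3) by (intro d(2)) (auto simp: powr_powr)
  qed (use d in simp)
qed

lemma mittag_leffler_0: "mittag_leffler a b 0 = 1 / Gamma b"
  using powser_zero[of "\<lambda>k. 1 / Gamma (real k * a + b)"] by (simp add: mittag_leffler_def)

section \<open>Positivity, two-sided bounds and decay of the resolvents\<close>

context
  fixes a :: real
  assumes a: "0 < a" "a < 1"
begin

lemma frac_kernel_conv_resolvent_a:
  assumes "0 < t"
  shows "has_convolution (frac_kernel a) (frac_resolvent a a) t (frac_kernel a t - frac_resolvent a a t)"
  using frac_kernel_resolvent_convolution[OF a a(1) a(1) assms] frac_resolvent_shift[OF a a(1) assms] by simp

lemma frac_kernel_conv_resolvent_1:
  assumes "0 < t"
  shows "has_convolution (frac_kernel a) (frac_resolvent a 1) t (1 - frac_resolvent a 1 t)"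
  using frac_kernel_resolvent_convolution[OF a _ a(1) assms, of 1] frac_resolvent_shift[OF a _ assms, of 1] assms
  by (simp add: frac_kernel_def add.commute)

text \<open>Writing \<open>s = t - (t - s)\<close> reduces the weight to \<open>t\<close> times the
  resolvent equation minus a convolution with \<open>x k(x)\<close>, which is \<open>a\<close> times
  the kernel of order \<open>a + 1\<close>. The two pure kernel terms then cancel.\<close>

lemma frac_kernel_conv_time_weighted_resolvent:
  assumes "0 < t"
  shows "has_convolution (frac_kernel a) (\<lambda>s. s * frac_resolvent a a s) t
    (a * (1 - frac_resolvent a 1 t) - t * frac_resolvent a a t)"
proof -
  have wt: "x * frac_kernel a x = a * frac_kernel (a + 1) x" if "0 < x" for x
  proof -
    have "Gamma (a + 1) = a * Gamma a"
      using a by (intro Gamma_plus1) (auto dest!: nonpos_Ints_nonpos)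
    moreover have "x * x powr (a - 1) = x powr a"
      using powr_add[of x 1 "a - 1"] that by simp
    ultimately show ?thesis using a by (simp add: frac_kernel_def)
  qed
  have s1: "frac_resolvent a (a + 1) t = 1 - frac_resolvent a 1 t"
    using frac_resolvent_shift[OF a _ assms, of 1] assms by (simp add: frac_kernel_def add.commute)
  have "has_convolution (frac_kernel (a + 1)) (frac_resolvent a a) t (frac_resolvent a (a + 1 + a) t)"
    using a by (intro frac_kernel_resolvent_convolution assms) auto
  moreover have "frac_resolvent a (a + 1 + a) t = frac_kernel (a + 1) t - (1 - frac_resolvent a 1 t)"
    using frac_resolvent_shift[OF a _ assms, of "a + 1"] a s1 by simp
  ultimately have "has_bochner_integral lborel
     (\<lambda>s. t * (indicator {0<..<t} s * (frac_kernel a (t - s) * frac_resolvent a a s)) -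
          a * (indicator {0<..<t} s * (frac_kernel (a + 1) (t - s) * frac_resolvent a a s)))
     (t * (frac_kernel a t - frac_resolvent a a t) - a * (frac_kernel (a + 1) t - (1 - frac_resolvent a 1 t)))"
    using frac_kernel_conv_resolvent_a[OF assms] unfolding has_convolution_def
    by (intro has_bochner_integral_diff has_bochner_integral_mult_right) auto
  moreover have "t * (indicator {0<..<t} s * (frac_kernel a (t - s) * frac_resolvent a a s)) -
          a * (indicator {0<..<t} s * (frac_kernel (a + 1) (t - s) * frac_resolvent a a s)) =
        indicator {0<..<t} s * (frac_kernel a (t - s) * (s * frac_resolvent a a s))" for s
  proof (cases "s \<in> {0<..<t}")
    case True
    then have "t * frac_kernel a (t - s) = s * frac_kernel a (t - s) + a * frac_kernel (a + 1) (t - s)"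
      using wt[of "t - s"] by (simp add: algebra_simps)
    then have "t * frac_kernel a (t - s) * frac_resolvent a a s =
        (s * frac_kernel a (t - s) + a * frac_kernel (a + 1) (t - s)) * frac_resolvent a a s"
      by simp
    then show ?thesis using True by (simp add: algebra_simps)
  qed simp
  ultimately show ?thesis
    using wt[OF assms] by (simp add: has_convolution_def algebra_simps)
qed

text \<open>Here \<open>F\<close> is the kernel itself, so \<open>t powr (1 - a) * F t\<close> is
  constant: the borderline case of the monotonicity hypothesis.\<close>

lemma frac_resolvent_a_pos:
  assumes "0 < t"
  shows "0 < frac_resolvent a a t"
proof -
  have "continuous_on UNIV (\<lambda>x. mittag_leffler a a (- x))"
    by (intro continuous_on_compose2[OF continuous_mittag_leffler[OF a a(1)]] continuous_intros) auto
  moreover have "0 < mittag_leffler a a (- 0)" using a by (simp add: mittag_leffler_0)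
  ultimately obtain \<delta> where \<delta>: "0 < \<delta>" "\<And>t. 0 < t \<Longrightarrow> t < \<delta> \<Longrightarrow> 0 < mittag_leffler a a (- (t powr a))"
    using eventually_pos_powr_at_0[OF _ _ a(1)] by blast
  show ?thesis
  proof (rule volterra_solution_pos[OF a continuous_frac_resolvent frac_kernel_conv_resolvent_a _ \<delta>(1) _ assms])
    show "s powr (1 - a) * frac_kernel a s \<le> t powr (1 - a) * frac_kernel a t" if "0 < s" "s \<le> t" for s t
      using that by (simp add: frac_kernel_def flip: powr_add)
    show "0 < frac_resolvent a a t" if "0 < t" "t < \<delta>" for t
      using \<delta>(2)[OF that] that by (simp add: frac_resolvent_def)
  qed (use a in auto)
qed

text \<open>The integral of \<open>r\<close> over \<open>(0, t)\<close> is \<open>1 - g(t)\<close>,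
  and positivity of \<open>r\<close> gives \<open>g \<le> 1\<close>. In \<open>g = l*r\<close> the
  decreasing kernel \<open>l\<close> is replaced by its smallest value \<open>l(t)\<close>, so
  \<open>g(t) \<ge> l(t) (1 - g(t))\<close>.\<close>

lemma frac_resolvent_1_lower:
  assumes "0 < t"
  shows "1 \<le> frac_resolvent a 1 t * (1 + Gamma (1 - a) * t powr a)"
    and "0 < frac_resolvent a 1 t"
    and "frac_resolvent a 1 t \<le> 1"
proof -
  let ?g = "frac_resolvent a 1 t"
  have G: "0 < Gamma (1 - a)" using a by simp
  have pos: "0 < 1 + Gamma (1 - a) * t powr a" using G by (intro add_pos_nonneg) auto
  have g: "has_convolution (frac_kernel (1 - a)) (frac_resolvent a a) t ?g"
    using frac_kernel_resolvent_convolution[OF a a(1) _ assms, of "1 - a"] a by simp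
  have one: "has_convolution (frac_kernel 1) (frac_resolvent a a) t (1 - ?g)"
    using frac_kernel_resolvent_convolution[OF a a(1) _ assms, of 1] frac_resolvent_shift[OF a _ assms, of 1] assms
    by (simp add: frac_kernel_def)
  show "?g \<le> 1"
    using has_convolution_nonneg[OF one] frac_resolvent_a_pos frac_kernel_pos[of 1] by (force simp: less_imp_le)
  have "has_convolution (\<lambda>_. frac_kernel (1 - a) t) (frac_resolvent a a) t (frac_kernel (1 - a) t * (1 - ?g))"
    using has_bochner_integral_mult_right[OF one[unfolded has_convolution_def], of "frac_kernel (1 - a) t"]
    unfolding has_convolution_def
    by (rule has_bochner_integral_cong[THEN iffD1, rotated -1]) (auto simp: indicator_def frac_kernel_def)
  then have "frac_kernel (1 - a) t * (1 - ?g) \<le> ?g"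
  proof (rule has_convolution_mono[OF _ g])
    fix s assume s: "0 < s" "s < t"
    have "t powr (- a) \<le> (t - s) powr (- a)" using s a by (intro powr_mono2') auto
    then have "frac_kernel (1 - a) t \<le> frac_kernel (1 - a) (t - s)"
      using G by (simp add: frac_kernel_def divide_right_mono)
    then show "frac_kernel (1 - a) t * frac_resolvent a a s \<le> frac_kernel (1 - a) (t - s) * frac_resolvent a a s"
      using frac_resolvent_a_pos[OF s(1)] by (intro mult_right_mono) auto
  qed
  moreover have "frac_kernel (1 - a) t = 1 / (Gamma (1 - a) * t powr a)"
    using assms by (simp add: frac_kernel_def powr_minus divide_simps)
  ultimately show *: "1 \<le> ?g * (1 + Gamma (1 - a) * t powr a)"
    using G assms by (simp add: field_simps)
  then have "0 < ?g * (1 + Gamma (1 - a) * t powr a)" by linarith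
  then show "0 < ?g"
    using pos by (simp add: zero_less_mult_iff)
qed

lemma frac_resolvent_1_antimono:
  assumes "0 < s" "s \<le> t"
  shows "frac_resolvent a 1 t \<le> frac_resolvent a 1 s"
proof (rule DERIV_nonpos_imp_nonincreasing[OF assms(2)])
  fix x assume "s \<le> x" "x \<le> t"
  then show "\<exists>y. (frac_resolvent a 1 has_real_derivative y) (at x) \<and> y \<le> 0"
    using frac_resolvent_1_has_derivative[OF a, of x] frac_resolvent_a_pos[of x] assms
    by (intro exI[of _ "- frac_resolvent a a x"]) auto
qed

text \<open>In \<open>1 - g = k*g\<close> the decreasing function \<open>g\<close> is replaced by
  its smallest value \<open>g(t)\<close>, leaving the integral of \<open>k\<close>.\<close>

lemma frac_resolvent_1_upper:
  assumes "0 < t"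
  shows "frac_resolvent a 1 t * t powr a \<le> Gamma (a + 1)"
proof -
  let ?g = "frac_resolvent a 1 t"
  have "has_bochner_integral lborel (\<lambda>s. ?g * (indicator {0<..<t} s * (frac_kernel a (t - s) * frac_kernel 1 s)))
      (?g * frac_kernel (a + 1) t)"
    using frac_kernel_convolution[OF a(1) _ assms, of 1] unfolding has_convolution_def
    by (intro has_bochner_integral_mult_right) auto
  then have "has_convolution (frac_kernel a) (\<lambda>s. ?g * frac_kernel 1 s) t (?g * frac_kernel (a + 1) t)"
    by (simp add: has_convolution_def mult_ac)
  then have "?g * frac_kernel (a + 1) t \<le> 1 - ?g"
  proof (rule has_convolution_mono[OF _ frac_kernel_conv_resolvent_1[OF assms]])
    fix s assume s: "0 < s" "s < t"
    then show "frac_kernel a (t - s) * (?g * frac_kernel 1 s) \<le> frac_kernel a (t - s) * frac_resolvent a 1 s"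
      using frac_kernel_pos[OF a(1), of "t - s"] frac_resolvent_1_antimono[of s t]
      by (intro mult_left_mono) (auto simp: frac_kernel_def)
  qed
  then have "?g * frac_kernel (a + 1) t \<le> 1"
    using frac_resolvent_1_lower(2)[OF assms] by simp
  moreover have "0 < Gamma (a + 1)" using a by simp
  ultimately show ?thesis
    by (simp add: frac_kernel_def field_simps)
qed

text \<open>The convolution of \<open>k\<close> with \<open>s r(s)\<close> is nonnegative, and its
  value is \<open>a (1 - g) - t r\<close>.\<close>

lemma time_weighted_resolvent_le:
  assumes "0 < t"
  shows "t * frac_resolvent a a t \<le> a"
proof -
  have "0 \<le> a * (1 - frac_resolvent a 1 t) - t * frac_resolvent a a t"
    using frac_resolvent_a_pos frac_kernel_pos[OF a(1)]
    by (intro has_convolution_nonneg[OF frac_kernel_conv_time_weighted_resolvent[OF assms]]) (simp add: less_imp_le)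
  moreover have "a * (1 - frac_resolvent a 1 t) \<le> a * 1"
    using a frac_resolvent_1_lower(2)[OF assms] by (intro mult_left_mono) auto
  ultimately show ?thesis by simp
qed

text \<open>The choice \<open>M = a / (1 - a)\<close> makes \<open>(M - a) (1 - a) = a\<^sup>2\<close>, which together with \<open>t r \<le> a\<close> is what
  monotonicity of \<open>t\<^bsup>1-a\<^esup> (M - a (1 - g))\<close> requires.\<close>

lemma time_weighted_resolvent_less:
  assumes "0 < t"
  shows "t * frac_resolvent a a t < a / (1 - a) * frac_resolvent a 1 t"
proof -
  define M where "M = a / (1 - a)"
  have M: "0 < M" "(M - a) * (1 - a) = a * a" using a by (auto simp: M_def field_simps)
  let ?F = "\<lambda>t. M - a * (1 - frac_resolvent a 1 t)"
  let ?z = "\<lambda>t. M * frac_resolvent a 1 t - t * frac_resolvent a a t"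
  \<comment> \<open>In the variable \<open>x = t powr a\<close> the difference
    \<open>M g - t r\<close> becomes this continuous function, with value \<open>M\<close> at
    0.\<close>
  have "continuous_on UNIV (\<lambda>x. M * mittag_leffler a 1 (- x) - x * mittag_leffler a a (- x))"
    using a by (intro continuous_intros continuous_on_compose2[OF continuous_mittag_leffler]) auto
  moreover have "0 < M * mittag_leffler a 1 (- 0) - 0 * mittag_leffler a a (- 0)"
    using M by (simp add: mittag_leffler_0)
  ultimately obtain \<delta> where \<delta>: "0 < \<delta>" "\<And>t. 0 < t \<Longrightarrow> t < \<delta> \<Longrightarrow>
      0 < M * mittag_leffler a 1 (- (t powr a)) - t powr a * mittag_leffler a a (- (t powr a))"
    using eventually_pos_powr_at_0[OF _ _ a(1)] by blast
  have "0 < ?z t"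
  proof (rule volterra_solution_pos[where z="?z" and F="?F", OF a _ _ _ \<delta>(1) _ assms])
    show "continuous_on {0<..} ?z"
      using a by (intro continuous_intros continuous_frac_resolvent) auto
    show "has_convolution (frac_kernel a) ?z t (?F t - ?z t)" if t: "0 < t" for t
    proof -
      have "has_bochner_integral lborel
        (\<lambda>s. M * (indicator {0<..<t} s * (frac_kernel a (t - s) * frac_resolvent a 1 s)) -
             indicator {0<..<t} s * (frac_kernel a (t - s) * (s * frac_resolvent a a s)))
        (M * (1 - frac_resolvent a 1 t) - (a * (1 - frac_resolvent a 1 t) - t * frac_resolvent a a t))"
        using frac_kernel_conv_resolvent_1[OF t] frac_kernel_conv_time_weighted_resolvent[OF t]
        unfolding has_convolution_def
        by (intro has_bochner_integral_diff has_bochner_integral_mult_right) auto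
      then show ?thesis by (simp add: has_convolution_def algebra_simps)
    qed
    show "s powr (1 - a) * ?F s \<le> t powr (1 - a) * ?F t" if "0 < s" "s \<le> t" for s t
    proof (rule DERIV_nonneg_imp_nondecreasing[OF that(2)])
      fix x assume "s \<le> x" "x \<le> t"
      then have x: "0 < x" using that by simp
      let ?D = "(1 - a) * x powr (- a) * ?F x + x powr (1 - a) * (- (a * frac_resolvent a a x))"
      have "((\<lambda>x. x powr (1 - a)) has_real_derivative (1 - a) * x powr (- a)) (at x)"
        using has_real_derivative_powr[OF x, of "1 - a"] by simp
      moreover have "(?F has_real_derivative (- (a * frac_resolvent a a x))) (at x)"
        using frac_resolvent_1_has_derivative[OF a x] by (auto intro!: derivative_eq_intros)
      ultimately have "((\<lambda>x. x powr (1 - a) * ?F x) has_real_derivative ?D) (at x)"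
        by (rule DERIV_mult'[THEN DERIV_cong]) simp
      moreover have "0 \<le> ?D"
      proof -
        have "x powr (1 - a) = x powr (- a) * x" using powr_add[of x "- a" 1] x by simp
        then have "?D = x powr (- a) * ((M - a) * (1 - a) + (1 - a) * a * frac_resolvent a 1 x
            - a * (x * frac_resolvent a a x))"
          by (simp add: algebra_simps)
        moreover have "a * (x * frac_resolvent a a x) \<le> a * a"
          using a time_weighted_resolvent_le[OF x] by (intro mult_left_mono) auto
        moreover have "0 \<le> (1 - a) * a * frac_resolvent a 1 x"
          using a frac_resolvent_1_lower(2)[OF x] by simp
        ultimately show ?thesis using M by simp
      qed
      ultimately show "\<exists>y. ((\<lambda>x. x powr (1 - a) * ?F x) has_real_derivative y) (at x) \<and> 0 \<le> y"
        by blast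
    qed
    show "0 < ?z t" if t: "0 < t" "t < \<delta>" for t
    proof -
      have "t * t powr (a - 1) = t powr a" using powr_add[of t 1 "a - 1"] t by simp
      then have "t * frac_resolvent a a t = t powr a * mittag_leffler a a (- (t powr a))"
        by (metis frac_resolvent_def mult.assoc)
      moreover have "frac_resolvent a 1 t = mittag_leffler a 1 (- (t powr a))"
        using t by (simp add: frac_resolvent_def)
      ultimately show ?thesis using \<delta>(2)[OF t] by simp
    qed
  qed
  then show ?thesis by (simp add: M_def)
qed

text \<open>Mean value theorem with \<open>g' = -r\<close>. The bound on \<open>r\<close> multiplies
  \<open>x r \<le> M g\<close> by \<open>x powr a\<close> and uses the upper bound on
  \<open>g\<close>; its decay in \<open>x\<close> then allows \<open>x\<close> to be replaced by
  \<open>s\<close>.\<close>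

lemma frac_resolvent_1_lipschitz:
  assumes "0 < s" "s < t"
  shows "\<bar>frac_resolvent a 1 s - frac_resolvent a 1 t\<bar> \<le>
    a / (1 - a) * Gamma (a + 1) * (t - s) * s powr (-1 - a)"
proof -
  have "\<exists>x. s < x \<and> x < t \<and> frac_resolvent a 1 t - frac_resolvent a 1 s = (t - s) * (- frac_resolvent a a x)"
    using assms frac_resolvent_1_has_derivative[OF a] by (intro MVT2) auto
  then obtain x where x: "s < x" "x < t" and
    eq: "frac_resolvent a 1 s - frac_resolvent a 1 t = (t - s) * frac_resolvent a a x"
    by auto
  have x0: "0 < x" using x assms by simp
  have G: "0 < Gamma (a + 1)" using a by simp
  have "x powr (1 + a) * frac_resolvent a a x = x powr a * (x * frac_resolvent a a x)"
    using x0 by (simp add: powr_add)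
  also have "\<dots> \<le> x powr a * (a / (1 - a) * frac_resolvent a 1 x)"
    using time_weighted_resolvent_less[OF x0] by (intro mult_left_mono) auto
  also have "\<dots> = a / (1 - a) * (frac_resolvent a 1 x * x powr a)" by simp
  also have "\<dots> \<le> a / (1 - a) * Gamma (a + 1)"
    using a by (intro mult_left_mono frac_resolvent_1_upper x0) auto
  finally have "frac_resolvent a a x \<le> (a / (1 - a) * Gamma (a + 1)) / x powr (1 + a)"
    using x0 by (subst pos_le_divide_eq) (auto simp: mult.commute)
  also have "\<dots> = a / (1 - a) * Gamma (a + 1) * x powr (- (1 + a))"
    by (subst powr_minus_divide) simp
  also have "\<dots> \<le> a / (1 - a) * Gamma (a + 1) * s powr (- (1 + a))"
    using a G x assms by (intro mult_left_mono powr_mono2') auto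
  finally have "(t - s) * frac_resolvent a a x \<le> (t - s) * (a / (1 - a) * Gamma (a + 1) * s powr (- (1 + a)))"
    using assms by (intro mult_left_mono) auto
  moreover have "0 \<le> (t - s) * frac_resolvent a a x"
    using frac_resolvent_a_pos[OF x0] assms by simp
  moreover have "- (1 + a) = -1 - a" by simp
  ultimately show ?thesis unfolding eq by (simp add: mult_ac)
qed

end

section \<open>Orthonormal series and square-summable coefficients\<close>

text \<open>Riesz-Fischer: by Pythagoras, distances of partial sums are differences of partial sums
  of squares, so the series is Cauchy.\<close>

lemma orthonormal_series_summable:
  fixes \<phi> :: "nat \<Rightarrow> 'a::{real_inner,complete_space}"
  assumes on: "\<And>m n. inner (\<phi> m) (\<phi> n) = (if m = n then 1 else 0)"
    and c: "summable (\<lambda>n. (c n)\<^sup>2)"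
  shows "summable (\<lambda>n. c n *\<^sub>R \<phi> n)"
proof -
  have norm_eq: "(norm (\<Sum>n\<in>S. c n *\<^sub>R \<phi> n))\<^sup>2 = (\<Sum>n\<in>S. (c n)\<^sup>2)" if "finite S" for S
    using norm_sum_Pythagorean[OF that, of "\<lambda>n. c n *\<^sub>R \<phi> n"]
    by (simp add: pairwise_def orthogonal_def on norm_eq_sqrt_inner power_mult_distrib sum_nonneg)
  let ?S = "\<lambda>n. \<Sum>k<n. c k *\<^sub>R \<phi> k" and ?s = "\<lambda>n. \<Sum>k<n. (c k)\<^sup>2"
  have split: "sum f {..<n} - sum f {..<m} = sum f {m..<n}" if "m \<le> n" for f :: "nat \<Rightarrow> 'b::ab_group_add" and m n
    using sum_diff_nat_ivl[of 0 m n f] that by (simp add: atLeast0LessThan)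
  have "Cauchy ?s"
    using c by (simp add: summable_iff_convergent convergent_Cauchy)
  have "Cauchy ?S"
  proof (rule CauchyI')
    fix e :: real assume "0 < e"
    then obtain N where N: "\<And>m n. m \<ge> N \<Longrightarrow> n \<ge> N \<Longrightarrow> norm (?s m - ?s n) < e\<^sup>2"
      using CauchyD[OF \<open>Cauchy ?s\<close>, of "e\<^sup>2"] by auto
    have "dist (?S m) (?S n) < e" if "m \<ge> N" "n > m" for m n
    proof (rule power_less_imp_less_base[where n=2])
      have "(dist (?S m) (?S n))\<^sup>2 = ?s n - ?s m"
        using norm_eq[of "{m..<n}"] that by (subst dist_commute) (simp add: dist_norm split)
      then show "(dist (?S m) (?S n))\<^sup>2 < e\<^sup>2"
        using N[of n m] that by simp
    qed (use \<open>0 < e\<close> in simp)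
    then show "\<exists>N. \<forall>m\<ge>N. \<forall>n>m. dist (?S m) (?S n) < e" by blast
  qed
  then show ?thesis
    by (simp add: summable_iff_convergent Cauchy_convergent_iff)
qed

lemma orthonormal_series_coefficient:
  fixes \<phi> :: "nat \<Rightarrow> 'a::{real_inner,complete_space}"
  assumes on: "\<And>m n. inner (\<phi> m) (\<phi> n) = (if m = n then 1 else 0)"
    and c: "summable (\<lambda>n. (c n)\<^sup>2)"
  shows "inner (\<Sum>n. c n *\<^sub>R \<phi> n) (\<phi> m) = c m"
proof -
  have "(\<lambda>n. inner (c n *\<^sub>R \<phi> n) (\<phi> m)) sums inner (\<Sum>n. c n *\<^sub>R \<phi> n) (\<phi> m)"
    by (intro bounded_linear.sums[OF bounded_linear_inner_left] summable_sums
        orthonormal_series_summable[OF on c])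
  moreover have "(\<lambda>n. inner (c n *\<^sub>R \<phi> n) (\<phi> m)) = (\<lambda>n. if n = m then c n else 0)"
    by (auto simp: on)
  ultimately show ?thesis
    using sums_single[of m c] sums_unique2 by force
qed

lemma orthonormal_basis_Parseval:
  fixes \<phi> :: "nat \<Rightarrow> 'a::real_inner"
  assumes "(\<lambda>n. inner v (\<phi> n) *\<^sub>R \<phi> n) sums v"
  shows "(\<lambda>n. (inner v (\<phi> n))\<^sup>2) sums (norm v)\<^sup>2"
  using bounded_linear.sums[OF bounded_linear_inner_right assms, of v]
  by (simp add: power2_eq_square dot_square_norm)

text \<open>The vectors \<open>p\<close> and \<open>q\<close> carry the absolute values as
  coefficients. Parseval compares \<open>v\<close> with
  \<open>K *\<^sub>R (p + D *\<^sub>R q)\<close>, and the triangle inequality in the Hilbert space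
  takes the place of Minkowski for sequences.\<close>

lemma norm_le_of_coefficients:
  fixes \<phi> :: "nat \<Rightarrow> 'a::{real_inner,complete_space}"
  assumes on: "\<And>m n. inner (\<phi> m) (\<phi> n) = (if m = n then 1 else 0)"
    and basis: "\<And>v. (\<lambda>n. inner v (\<phi> n) *\<^sub>R \<phi> n) sums v"
    and x: "summable (\<lambda>n. (x n)\<^sup>2)" and "0 \<le> K" "0 \<le> D"
    and le: "\<And>n. \<bar>inner v (\<phi> n)\<bar> \<le> K * (\<bar>x n\<bar> + D * \<bar>inner w (\<phi> n)\<bar>)"
  shows "norm v \<le> K * (sqrt (\<Sum>n. (x n)\<^sup>2) + D * norm w)"
proof -
  note Parseval = orthonormal_basis_Parseval[OF basis]
  define p where "p = (\<Sum>n. \<bar>x n\<bar> *\<^sub>R \<phi> n)"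
  define q where "q = (\<Sum>n. \<bar>inner w (\<phi> n)\<bar> *\<^sub>R \<phi> n)"
  have p: "inner p (\<phi> n) = \<bar>x n\<bar>" for n
    unfolding p_def using x by (intro orthonormal_series_coefficient[OF on]) simp
  have q: "inner q (\<phi> n) = \<bar>inner w (\<phi> n)\<bar>" for n
    unfolding q_def using Parseval[of w] by (intro orthonormal_series_coefficient[OF on]) (simp add: sums_iff)
  have np: "norm p = sqrt (\<Sum>n. (x n)\<^sup>2)"
    using Parseval[of p] by (simp add: p sums_iff)
  have nq: "norm q = norm w"
  proof -
    have "(norm q)\<^sup>2 = (norm w)\<^sup>2"
      using Parseval[of q] unfolding q power2_abs by (rule sums_unique2) (rule Parseval)
    then show ?thesis by simp
  qed
  have "(norm v)\<^sup>2 \<le> (norm (K *\<^sub>R (p + D *\<^sub>R q)))\<^sup>2"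
  proof (rule sums_le[OF _ Parseval Parseval])
    fix n
    have "\<bar>inner v (\<phi> n)\<bar> \<le> \<bar>inner (K *\<^sub>R (p + D *\<^sub>R q)) (\<phi> n)\<bar>"
      using le[of n] by (simp add: inner_add_left p q)
    then show "(inner v (\<phi> n))\<^sup>2 \<le> (inner (K *\<^sub>R (p + D *\<^sub>R q)) (\<phi> n))\<^sup>2"
      by (simp only: abs_le_square_iff)
  qed
  then have "norm v \<le> norm (K *\<^sub>R (p + D *\<^sub>R q))"
    by (rule power2_le_imp_le) simp
  also have "\<dots> \<le> K * (norm p + norm (D *\<^sub>R q))"
    using \<open>0 \<le> K\<close> norm_triangle_ineq[of p "D *\<^sub>R q"] by (simp add: mult_left_mono)
  finally show ?thesis
    using \<open>0 \<le> D\<close> by (simp add: np nq)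
qed

lemma summable_square_bounded:
  fixes c d :: "nat \<Rightarrow> real"
  assumes "summable (\<lambda>n. (d n)\<^sup>2)" "\<And>n. \<bar>c n\<bar> \<le> K * \<bar>d n\<bar>"
  shows "summable (\<lambda>n. (c n)\<^sup>2)"
proof (rule summable_comparison_test')
  show "summable (\<lambda>n. K\<^sup>2 * (d n)\<^sup>2)" using assms(1) by (rule summable_mult)
  fix n
  have "\<bar>c n\<bar>\<^sup>2 \<le> (K * \<bar>d n\<bar>)\<^sup>2" using assms(2)[of n] by (intro power_mono) auto
  then show "norm ((c n)\<^sup>2) \<le> K\<^sup>2 * (d n)\<^sup>2" by (simp add: power_mult_distrib)
qed

lemma summable_square_diff:
  fixes c d :: "nat \<Rightarrow> real"
  assumes "summable (\<lambda>n. (c n)\<^sup>2)" "summable (\<lambda>n. (d n)\<^sup>2)"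
  shows "summable (\<lambda>n. (c n - d n)\<^sup>2)"
proof (rule summable_comparison_test')
  show "summable (\<lambda>n. 2 * (c n)\<^sup>2 + 2 * (d n)\<^sup>2)" using assms by (intro summable_add summable_mult)
  show "norm ((c n - d n)\<^sup>2) \<le> 2 * (c n)\<^sup>2 + 2 * (d n)\<^sup>2" for n
    using zero_le_power2[of "c n + d n"] zero_le_power2[of "c n - d n"]
    unfolding real_norm_def abs_power2 by (simp add: power2_sum power2_diff)
qed

section \<open>Mittag-Leffler bounds with explicit dependence on the eigenvalue\<close>

text \<open>Rescaling time by \<open>l powr (1 / a)\<close> absorbs the eigenvalue, so the bounds
  above carry over to every mode.\<close>

lemma mittag_leffler_eq_frac_resolvent:
  assumes "0 < a" "0 < l" "0 < t"
  shows "mittag_leffler a 1 (- l * t powr a) = frac_resolvent a 1 (l powr (1 / a) * t)"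
  using assms by (simp add: frac_resolvent_def powr_mult powr_powr)

text \<open>The lower bound controls division by \<open>g\<close>; the upper bound is the smoothing
  that makes \<open>A F(t)\<close> bounded on L2.\<close>

lemma
  assumes a: "0 < a" "a < 1" and "0 < l" "0 < t"
  shows mittag_leffler_nonneg: "0 \<le> mittag_leffler a 1 (- l * t powr a)"
    and mittag_leffler_le_1: "mittag_leffler a 1 (- l * t powr a) \<le> 1"
    and mittag_leffler_lower: "1 \<le> mittag_leffler a 1 (- l * t powr a) * (1 + Gamma (1 - a) * (l * t powr a))"
    and mittag_leffler_upper: "l * mittag_leffler a 1 (- l * t powr a) \<le> Gamma (a + 1) * t powr (- a)"
proof -
  have s: "0 < l powr (1 / a) * t" "(l powr (1 / a) * t) powr a = l * t powr a"
    using assms by (auto simp: powr_mult powr_powr)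
  note eq = mittag_leffler_eq_frac_resolvent[OF a(1) \<open>0 < l\<close> \<open>0 < t\<close>]
  show "0 \<le> mittag_leffler a 1 (- l * t powr a)" "mittag_leffler a 1 (- l * t powr a) \<le> 1"
    "1 \<le> mittag_leffler a 1 (- l * t powr a) * (1 + Gamma (1 - a) * (l * t powr a))"
    using frac_resolvent_1_lower[OF a s(1)] unfolding s(2) eq by simp_all
  have "frac_resolvent a 1 (l powr (1 / a) * t) * (l * t powr a) \<le> Gamma (a + 1)"
    using frac_resolvent_1_upper[OF a s(1)] unfolding s(2) .
  then show "l * mittag_leffler a 1 (- l * t powr a) \<le> Gamma (a + 1) * t powr (- a)"
    using \<open>0 < t\<close> unfolding eq by (simp add: powr_minus_divide pos_le_divide_eq mult_ac)
qed

text \<open>With \<open>m powr a = l\<close> the rescaling contributes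
  \<open>m * m powr (-1 - a) = 1 / l\<close>. The factor \<open>l\<close> on the left cancels it, so
  the constant does not depend on the mode.\<close>

lemma mittag_leffler_time_lipschitz:
  assumes a: "0 < a" "a < 1" and "0 < l" "0 < t" "t < t'"
  shows "l * \<bar>mittag_leffler a 1 (- l * t powr a) - mittag_leffler a 1 (- l * t' powr a)\<bar> \<le>
    a / (1 - a) * Gamma (a + 1) * (t' - t) * t powr (-1 - a)"
proof -
  define m where "m = l powr (1 / a)"
  have m: "0 < m" using assms by (simp add: m_def)
  have "m powr (-1 - a) = 1 / (m * l)"
  proof -
    have "m powr (1 + a) = m * l"
      using m assms by (simp add: powr_add) (simp add: m_def powr_powr)
    then show ?thesis using powr_minus_divide[of m "1 + a"] by simp
  qed
  then have pm: "(m * t) powr (-1 - a) = t powr (-1 - a) / (m * l)"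
    using m assms by (simp add: powr_mult)
  have "\<bar>frac_resolvent a 1 (m * t) - frac_resolvent a 1 (m * t')\<bar> \<le>
      a / (1 - a) * Gamma (a + 1) * (m * t' - m * t) * (m * t) powr (-1 - a)"
    using m assms by (intro frac_resolvent_1_lipschitz) auto
  then have "l * \<bar>frac_resolvent a 1 (m * t) - frac_resolvent a 1 (m * t')\<bar> \<le>
      l * (a / (1 - a) * Gamma (a + 1) * (m * t' - m * t) * (t powr (-1 - a) / (m * l)))"
    unfolding pm using assms by (intro mult_left_mono) auto
  also have "m * t' - m * t = m * (t' - t)" by (simp add: algebra_simps)
  also have "l * (a / (1 - a) * Gamma (a + 1) * (m * (t' - t)) * (t powr (-1 - a) / (m * l))) =
      a / (1 - a) * Gamma (a + 1) * (t' - t) * t powr (-1 - a)"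
    using m assms by simp
  finally show ?thesis
    using assms mittag_leffler_eq_frac_resolvent[OF a(1) \<open>0 < l\<close>] by (simp add: m_def)
qed

section \<open>Coefficients of the solution and the stability estimate\<close>

text \<open>Regrouping isolates \<open>fc n / lam n\<close>, which depends neither on time nor on
  the initial datum and so drops out of differences of solutions. Its square-summability is the
  \<open>in_Hdot\<close> hypothesis.\<close>

lemma solP_coefficient:
  fixes phi :: "nat \<Rightarrow> 'a::{real_inner,complete_space}"
  assumes a: "0 < a" "a < 1" and spec: "dirichlet_spectrum lam phi" and f: "in_Hdot lam (-2) fc" and "0 < t"
  shows "inner (solP a lam phi fc u t) (phi n) =
    mittag_leffler a 1 (- lam n * t powr a) * inner (u - Ainv lam phi fc) (phi n) + fc n / lam n"
proof -
  let ?g = "\<lambda>n. mittag_leffler a 1 (- lam n * t powr a)"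
  have lam: "\<And>n. 0 < lam n"
    and on: "\<And>m n. inner (phi m) (phi n) = (if m = n then 1 else 0)"
    and basis: "\<And>v. (\<lambda>n. inner v (phi n) *\<^sub>R phi n) sums v"
    using spec by (auto simp: dirichlet_spectrum_def)
  have g: "0 \<le> ?g n" "?g n \<le> 1" for n
    using mittag_leffler_nonneg[OF a lam \<open>0 < t\<close>] mittag_leffler_le_1[OF a lam \<open>0 < t\<close>] by auto
  have "lam n powr (-2) * (fc n)\<^sup>2 = (fc n / lam n)\<^sup>2" for n
    using lam[of n] by (simp add: powr_minus_divide power_divide)
  then have sf: "summable (\<lambda>n. (fc n / lam n)\<^sup>2)"
    using f by (simp add: in_Hdot_def)
  have su: "summable (\<lambda>n. (inner u (phi n))\<^sup>2)"
    using orthonormal_basis_Parseval[OF basis] by (auto simp: sums_iff)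
  have "inner (solF a lam phi t u) (phi n) = ?g n * inner u (phi n)"
    unfolding solF_def
  proof (intro orthonormal_series_coefficient[OF on] summable_square_bounded[OF su])
    show "\<bar>?g n * inner u (phi n)\<bar> \<le> 1 * \<bar>inner u (phi n)\<bar>" for n
      unfolding abs_mult using g[of n] by (intro mult_right_mono) auto
  qed
  moreover have "inner (\<Sum>n. ((1 - ?g n) * fc n / lam n) *\<^sub>R phi n) (phi n) = (1 - ?g n) * fc n / lam n"
  proof (intro orthonormal_series_coefficient[OF on] summable_square_bounded[OF sf])
    have "\<bar>(1 - ?g n) * (fc n / lam n)\<bar> \<le> 1 * \<bar>fc n / lam n\<bar>" for n
      unfolding abs_mult using g[of n] by (intro mult_right_mono) auto
    then show "\<bar>(1 - ?g n) * fc n / lam n\<bar> \<le> 1 * \<bar>fc n / lam n\<bar>" for n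
      by simp
  qed
  moreover have "inner (Ainv lam phi fc) (phi n) = fc n / lam n"
    unfolding Ainv_def by (rule orthonormal_series_coefficient[OF on sf])
  ultimately show ?thesis
    by (simp add: solP_def inner_add_left inner_diff_left algebra_simps add_divide_distrib diff_divide_distrib)
qed

theorem mainTheorem2:
  fixes alpha :: real and lam :: "nat \<Rightarrow> real"
    and phi :: "nat \<Rightarrow> 'a::{real_inner,complete_space}" and fc :: "nat \<Rightarrow> real"
  assumes "0 < alpha" "alpha < 1"
    and "dirichlet_spectrum lam phi"
    and "in_Hdot lam (-2) fc"
  shows "\<exists>c>0. \<forall>T T' (u0::'a) (u0'::'a). 0 < T \<longrightarrow> T < T' \<longrightarrow>
     (let d = solP alpha lam phi fc u0 T - solP alpha lam phi fc u0' T' in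
       A_in_L2 lam phi d \<and>
       norm (u0 - u0') \<le> c * (1 + c * T' powr alpha) *
         (A_L2norm lam phi d + c * \<bar>T - T'\<bar> * T powr (-1 - alpha) * norm (u0 - Ainv lam phi fc)))"
proof -
  note a = assms(1,2)
  have lam: "\<And>n. 0 < lam n" and "mono lam"
    and on: "\<And>m n. inner (phi m) (phi n) = (if m = n then 1 else 0)"
    and basis: "\<And>v. (\<lambda>n. inner v (phi n) *\<^sub>R phi n) sums v"
    using assms(3) by (auto simp: dirichlet_spectrum_def)
  have lam0: "lam 0 \<le> lam n" for n using \<open>mono lam\<close> by (simp add: monoD)
  define G where "G = Gamma (1 - alpha)"
  define C where "C = alpha / (1 - alpha) * Gamma (alpha + 1)"
  \<comment> \<open>A single constant above \<open>1 / lam 0\<close>, \<open>G\<close> and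
    \<open>C\<close>; the summand 1 ensures \<open>G \<le> c * c\<close> as well.\<close>
  define c where "c = 1 + 1 / lam 0 + G + C"
  have GC: "0 < G" "0 < C" using a by (auto simp: G_def C_def)
  have c: "1 \<le> c" "1 / lam 0 \<le> c" "G \<le> c" "C \<le> c"
    using GC lam[of 0] by (auto simp: c_def)
  show ?thesis
  proof (intro exI[of _ c] conjI allI impI)
    show "0 < c" using c by simp
  next
    fix T T' :: real and u0 u0' :: 'a
    assume T: "0 < T" "T < T'"
    then have T': "0 < T'" by simp
    define d where "d = solP alpha lam phi fc u0 T - solP alpha lam phi fc u0' T'"
    define w where "w = u0 - Ainv lam phi fc"
    define w' where "w' = u0' - Ainv lam phi fc"
    define g where "g = (\<lambda>t n. mittag_leffler alpha 1 (- lam n * t powr alpha))"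
    define D where "D = C * (T' - T) * T powr (-1 - alpha)"
    define K where "K = 1 / lam 0 + G * T' powr alpha"
    have d: "inner d (phi n) = g T n * inner w (phi n) - g T' n * inner w' (phi n)" for n
      using solP_coefficient[OF a assms(3,4) T(1), of u0 n] solP_coefficient[OF a assms(3,4) T', of u0' n]
      by (simp add: d_def inner_diff_left g_def w_def w'_def)
    have sq: "summable (\<lambda>n. (inner v (phi n))\<^sup>2)" for v
      using orthonormal_basis_Parseval[OF basis] by (auto simp: sums_iff)
    \<comment> \<open>Smoothing at a positive time puts each part of \<open>d\<close> into the
      domain of \<open>A\<close>.\<close>
    have sg: "summable (\<lambda>n. (lam n * (g t n * inner v (phi n)))\<^sup>2)" if "0 < t" for t v
    proof (rule summable_square_bounded[OF sq])
      fix n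
      have "0 \<le> lam n * g t n" "lam n * g t n \<le> Gamma (alpha + 1) * t powr (- alpha)"
        using mittag_leffler_nonneg[OF a lam that, of n] mittag_leffler_upper[OF a lam that, of n] lam[of n]
        by (simp_all add: g_def)
      then have "\<bar>lam n * g t n\<bar> * \<bar>inner v (phi n)\<bar> \<le> (Gamma (alpha + 1) * t powr (- alpha)) * \<bar>inner v (phi n)\<bar>"
        by (intro mult_right_mono) auto
      then show "\<bar>lam n * (g t n * inner v (phi n))\<bar> \<le> (Gamma (alpha + 1) * t powr (- alpha)) * \<bar>inner v (phi n)\<bar>"
        by (simp add: abs_mult mult_ac)
    qed
    have L2: "summable (\<lambda>n. (lam n * inner d (phi n))\<^sup>2)"
      using summable_square_diff[OF sg[OF T(1), of w] sg[OF T', of w']] by (simp add: d right_diff_distrib)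
    have KD: "0 \<le> K" "0 \<le> D" using GC lam[of 0] T by (auto simp: K_def D_def)
    have "norm (u0 - u0') \<le> K * (sqrt (\<Sum>n. (lam n * inner d (phi n))\<^sup>2) + D * norm w)"
    proof (rule norm_le_of_coefficients[OF on basis L2 KD])
      fix n
      let ?e = "\<bar>inner (u0 - u0') (phi n)\<bar>" and ?h = "1 + G * (lam n * T' powr alpha)"
      have g': "0 \<le> g T' n" "1 \<le> g T' n * ?h"
        using mittag_leffler_nonneg[OF a lam T', of n] mittag_leffler_lower[OF a lam T', of n]
        by (simp_all add: g_def G_def)
      have h: "0 \<le> ?h" using GC lam[of n] by simp
      \<comment> \<open>Adding and subtracting \<open>g T' n * inner w (phi n)\<close> lets the time
        difference multiply \<open>w\<close> only, so \<open>w'\<close> does not enter the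
        bound.\<close>
      have "g T' n * inner (u0 - u0') (phi n) = inner d (phi n) + (g T' n - g T n) * inner w (phi n)"
        unfolding d by (simp add: w_def w'_def inner_diff_left algebra_simps)
      then have "g T' n * ?e = \<bar>inner d (phi n) + (g T' n - g T n) * inner w (phi n)\<bar>"
        using g'(1) by (metis abs_mult abs_of_nonneg)
      also have "\<dots> \<le> \<bar>inner d (phi n)\<bar> + \<bar>g T n - g T' n\<bar> * \<bar>inner w (phi n)\<bar>"
        by (metis abs_minus_commute abs_mult abs_triangle_ineq)
      finally have ge: "g T' n * ?e \<le> \<bar>inner d (phi n)\<bar> + \<bar>g T n - g T' n\<bar> * \<bar>inner w (phi n)\<bar>" .
      \<comment> \<open>Dividing by \<open>g T' n\<close> costs at most \<open>?h\<close>. Bounding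
        it by \<open>lam n * K\<close> provides the eigenvalue factor that turns \<open>d\<close>
        into \<open>A d\<close> and is needed for the Lipschitz bound.\<close>
      have hK: "?h \<le> lam n * K"
        using lam0[of n] lam[of 0] by (simp add: K_def distrib_left mult_ac)
      have "1 * ?e \<le> (g T' n * ?h) * ?e" by (intro mult_right_mono g') auto
      also have "\<dots> = ?h * (g T' n * ?e)" by simp
      also have "\<dots> \<le> (lam n * K) * (\<bar>inner d (phi n)\<bar> + \<bar>g T n - g T' n\<bar> * \<bar>inner w (phi n)\<bar>)"
        using hK ge h g' by (intro mult_mono) auto
      also have "\<dots> = K * (\<bar>lam n * inner d (phi n)\<bar> + (lam n * \<bar>g T n - g T' n\<bar>) * \<bar>inner w (phi n)\<bar>)"
        using lam[of n] by (simp add: abs_mult algebra_simps)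
      also have "\<dots> \<le> K * (\<bar>lam n * inner d (phi n)\<bar> + D * \<bar>inner w (phi n)\<bar>)"
        using mittag_leffler_time_lipschitz[OF a lam T, of n] KD
        by (intro mult_left_mono add_left_mono mult_right_mono) (auto simp: g_def D_def C_def)
      finally show "?e \<le> K * (\<bar>lam n * inner d (phi n)\<bar> + D * \<bar>inner w (phi n)\<bar>)" by simp
    qed
    also have "\<dots> = K * (A_L2norm lam phi d + D * norm w)"
      by (simp add: A_L2norm_def)
    also have "\<dots> \<le> (c * (1 + c * T' powr alpha)) *
        (A_L2norm lam phi d + c * \<bar>T - T'\<bar> * T powr (-1 - alpha) * norm w)"
    proof (rule mult_mono)
      have "1 * G \<le> c * c" using c GC by (intro mult_mono) auto
      then have "G * T' powr alpha \<le> c * c * T' powr alpha" by (intro mult_right_mono) auto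
      with c(2) show "K \<le> c * (1 + c * T' powr alpha)" by (simp add: K_def algebra_simps)
      have "D \<le> c * \<bar>T - T'\<bar> * T powr (-1 - alpha)"
        unfolding D_def using c T by (intro mult_right_mono mult_mono) auto
      then show "A_L2norm lam phi d + D * norm w \<le>
          A_L2norm lam phi d + c * \<bar>T - T'\<bar> * T powr (-1 - alpha) * norm w"
        by (intro add_left_mono mult_right_mono) auto
      show "0 \<le> c * (1 + c * T' powr alpha)" using c by simp
      show "0 \<le> A_L2norm lam phi d + D * norm w"
        using KD L2 by (simp add: A_L2norm_def suminf_nonneg)
    qed
    finally show "let d = solP alpha lam phi fc u0 T - solP alpha lam phi fc u0' T' in
       A_in_L2 lam phi d \<and>
       norm (u0 - u0') \<le> c * (1 + c * T' powr alpha) *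
         (A_L2norm lam phi d + c * \<bar>T - T'\<bar> * T powr (-1 - alpha) * norm (u0 - Ainv lam phi fc))"
      using L2 unfolding Let_def d_def[symmetric] A_in_L2_def w_def by simp
  qed
qed

end
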